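(* Let $q$ be any odd prime power. Then $\mathcal{S}_q$ and $\mathcal{O}_q$ are subgroups of $\mathbb{F}_q^*$ such that $\mathcal{O}_q\subseteq\mathcal{S}_q$. Further, write $q=2^st+1$ with $s\ge 1$ an integer and $t$ an odd integer. Then the subgroup $\mathcal{O}_q$ has exactly $t$ distinct elements and the set $\mathcal{S}_q\setminus\mathcal{O}_q$ contains exactly $(2^{s-1}-1)t$ elements. Further, $\mathcal{O}_q=\mathcal{S}_q$ if and only if $q\equiv 3\pmod 4$.
   Context: $\mathbb{F}_q$ is the finite field with $q$ elements and $\mathbb{F}_q^*$ its multiplicative group. $\mathcal{S}_q=\{a^2 : a\in\mathbb{F}_q^*\}$ is the set of nonzero squares, and $\mathcal{O}_q=\{a\in\mathbb{F}_q^* : \text{the multiplicative order of } a \text{ is odd}\}$. *)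

theory Defs
  imports "HOL-Algebra.Multiplicative_Group" "HOL-Number_Theory.Prime_Powers" "HOL-Number_Theory.Cong"
begin

definition nonzero_squares :: "('a, 'b) ring_scheme \<Rightarrow> 'a set" where
  "nonzero_squares F = {a [^]\<^bsub>mult_of F\<^esub> (2::nat) | a. a \<in> carrier (mult_of F)}"

text \<open>
  The function \<open>group.ord\<close> assigns \<open>0\<close> to elements of infinite order; these are therefore
  not of odd order.
\<close>

definition odd_order_elements :: "('a, 'b) ring_scheme \<Rightarrow> 'a set" where
  "odd_order_elements F = {a \<in> carrier (mult_of F). odd (group.ord (mult_of F) a)}"

end

theory Submission
  imports Defs
begin

text \<open>
  The multiplicative group of a finite field is cyclic of order \<open>N = q - 1\<close>, and everything
  follows from viewing both sets as sets of \<open>k\<close>-th powers in it. In a cyclic group with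
  generator \<open>g\<close>, the \<open>k\<close>-th powers form the subgroup generated by \<open>g\<^sup>k\<close>, which has
  \<open>N div k\<close> elements when \<open>k\<close> divides \<open>N\<close> (\<open>subgroup_powers\<close>, \<open>card_powers\<close>).
  The squares are the case \<open>k = 2\<close>. For \<open>N = 2\<^sup>s t\<close> with \<open>t\<close> odd, the elements of odd order
  are exactly the \<open>2\<^sup>s\<close>-th powers (\<open>coprime_ord_eq_powers\<close>): raising to the power \<open>2\<^sup>s\<close>
  kills the 2-part of the order, and conversely it permutes each cyclic group of odd order.

  Hence the elements of odd order form a subgroup of \<open>t\<close> elements inside the subgroup of squares,
  which has \<open>2\<^sup>s\<^sup>-\<^sup>1 t\<close> elements. The two agree precisely when \<open>s = 1\<close>, that is, when
  \<open>q = 2 t + 1\<close> with \<open>t\<close> odd.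
\<close>

text \<open>
  The exponents commute: \<open>(g\<^sup>i)\<^sup>k = (g\<^sup>k)\<^sup>i\<close>. Natural exponents suffice to describe the
  generated subgroup because the group is finite.
\<close>

lemma (in group) powers_eq_generate:
  fixes k :: nat
  assumes fin: "finite (carrier G)" and g: "g \<in> carrier G"
    and gen: "carrier G = {g [^] i | i::nat. i \<in> UNIV}"
  shows "(\<lambda>a. a [^] k) ` carrier G = generate G {g [^] k}"
proof -
  have "generate G {g [^] k} = {(g [^] k) [^] i | i. i \<in> (UNIV::nat set)}"
    using generate_pow_on_finite_carrier[OF fin] g by simp
  also have "\<dots> = (\<lambda>i::nat. (g [^] i) [^] k) ` UNIV"
    using g by (auto simp: nat_pow_pow mult.commute)
  also have "\<dots> = (\<lambda>a. a [^] k) ` carrier G"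
    unfolding gen by auto
  finally show ?thesis ..
qed

lemma (in group) subgroup_powers:
  fixes k :: nat
  assumes "finite (carrier G)" and "g \<in> carrier G"
    and "carrier G = {g [^] i | i::nat. i \<in> UNIV}"
  shows "subgroup ((\<lambda>a. a [^] k) ` carrier G) G"
  unfolding powers_eq_generate[OF assms] using assms(2) by (intro generate_is_subgroup) auto

lemma (in group) card_powers:
  fixes k :: nat
  assumes fin: "finite (carrier G)" and g: "g \<in> carrier G"
    and gen: "carrier G = {g [^] i | i::nat. i \<in> UNIV}"
    and dvd: "k dvd order G"
  shows "card ((\<lambda>a. a [^] k) ` carrier G) = order G div k"
proof -
  have ord: "ord g = order G"
    using generate_pow_card[OF g] generate_pow_on_finite_carrier[OF fin g] gen
    by (simp add: order_def)
  have "k \<noteq> 0"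
    using dvd fin by (metis dvd_0_left_iff less_irrefl order_gt_0_iff_finite)
  then show ?thesis
    using generate_pow_card[of "g [^] k"] ord_pow[OF g, of k] g dvd
    by (simp add: powers_eq_generate[OF fin g gen] ord)
qed

text \<open>
  An \<open>m\<close>-th power is killed by \<open>n\<close>, so its order divides \<open>n\<close> and is coprime to \<open>m\<close>.
  Conversely, if the order of \<open>a\<close> is coprime to \<open>m\<close>, then \<open>m\<close> is invertible modulo that order,
  and raising \<open>a\<close> to such an inverse gives an \<open>m\<close>-th root of \<open>a\<close>.
\<close>

lemma (in group) coprime_ord_eq_powers:
  assumes order: "order G = m * n" and cop: "coprime m n" and m: "m > 0"
  shows "{a \<in> carrier G. coprime m (ord a)} = (\<lambda>a. a [^] m) ` carrier G"
proof (intro equalityI subsetI)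
  fix a assume "a \<in> {a \<in> carrier G. coprime m (ord a)}"
  then have a: "a \<in> carrier G" and co: "coprime m (ord a)" by auto
  obtain x y where "m * x = ord a * y + 1"
    using bezout_nat[of m "ord a"] m co by (auto simp: coprime_iff_gcd_eq_1)
  then have "(a [^] x) [^] m = a [^] (ord a * y + 1)"
    using a by (simp add: nat_pow_pow mult.commute)
  also have "\<dots> = a"
    using a by (simp flip: nat_pow_mult nat_pow_pow)
  finally show "a \<in> (\<lambda>a. a [^] m) ` carrier G"
    using a by (metis image_eqI nat_pow_closed)
next
  fix b assume "b \<in> (\<lambda>a. a [^] m) ` carrier G"
  then obtain a where a: "a \<in> carrier G" and b: "b = a [^] m" by auto
  have "b [^] n = \<one>"
    using a pow_order_eq_1[OF a] by (simp add: b nat_pow_pow order)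
  then have "ord b dvd n"
    using a b pow_eq_id by simp
  then show "b \<in> {a \<in> carrier G. coprime m (ord a)}"
    using a b cop by (auto intro: coprime_divisors[of m m])
qed

lemma odd_order_elements_eq_powers:
  fixes F :: "('a, 'b) ring_scheme"
  assumes "group (mult_of F)" and "order (mult_of F) = 2 ^ s * t" and "s \<ge> 1" and "odd t"
  shows "odd_order_elements F = (\<lambda>a. a [^]\<^bsub>mult_of F\<^esub> (2 ^ s :: nat)) ` carrier (mult_of F)"
  using group.coprime_ord_eq_powers[OF assms(1,2)] assms(3,4)
  by (simp add: odd_order_elements_def)

theorem theorem4p1:
  fixes F :: "('a, 'b) ring_scheme" and q :: nat
  assumes "primepow q" and "odd q"
    and "field F" and "finite (carrier F)" and "order F = q"
  shows "subgroup (nonzero_squares F) (mult_of F)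
    \<and> subgroup (odd_order_elements F) (mult_of F)
    \<and> odd_order_elements F \<subseteq> nonzero_squares F
    \<and> (\<forall>s t :: nat. s \<ge> 1 \<and> odd t \<and> q = 2 ^ s * t + 1 \<longrightarrow>
          card (odd_order_elements F) = t
        \<and> card (nonzero_squares F - odd_order_elements F) = (2 ^ (s - 1) - 1) * t)
    \<and> (odd_order_elements F = nonzero_squares F \<longleftrightarrow> [q = 3] (mod 4))"
proof -
  let ?G = "mult_of F"
  let ?S = "nonzero_squares F" and ?O = "odd_order_elements F"
  interpret F: field F by fact
  interpret G: group ?G by (rule F.field_mult_group)
  have fin: "finite (carrier ?G)"
    using assms(4) by (rule F.finite_mult_of)
  have order: "order ?G = q - 1"
    using F.order_mult_of[OF assms(4)] assms(5) by simp
  obtain g where g: "g \<in> carrier ?G" and gen: "carrier ?G = {g [^]\<^bsub>?G\<^esub> i | i::nat. i \<in> UNIV}"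
    using F.finite_field_mult_group_has_gen[OF assms(4)] by (auto simp: nat_pow_mult_of)
  note powers = fin g gen
  have S: "?S = (\<lambda>a. a [^]\<^bsub>?G\<^esub> (2::nat)) ` carrier ?G"
    unfolding nonzero_squares_def by blast
  have "q > 1"
    using assms(1) by (rule primepow_gt_Suc_0[unfolded One_nat_def[symmetric]])

  have sub_S: "subgroup ?S ?G"
    unfolding S by (rule G.subgroup_powers[OF powers])
  have card_S: "card ?S = (q - 1) div 2"
    using G.card_powers[OF powers, of 2] assms(2) by (simp add: S order)

  have main: "subgroup ?O ?G \<and> ?O \<subseteq> ?S \<and> card ?O = t \<and> card ?S = 2 ^ (s - 1) * t"
    if s: "s \<ge> 1" and t: "odd t" and q: "q = 2 ^ s * t + 1" for s t :: nat
  proof -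
    have N: "order ?G = 2 ^ s * t"
      using order q by simp
    have O: "?O = (\<lambda>a. a [^]\<^bsub>?G\<^esub> (2 ^ s :: nat)) ` carrier ?G"
      by (rule odd_order_elements_eq_powers[OF G.group_axioms N s t])
    have two_s: "(2::nat) ^ s = 2 ^ (s - 1) * 2"
      using s by (cases s) auto
    have "?O \<subseteq> ?S"
    proof
      fix b assume "b \<in> ?O"
      then obtain a where a: "a \<in> carrier ?G" and b: "b = a [^]\<^bsub>?G\<^esub> (2 ^ s :: nat)"
        unfolding O by blast
      have "b = (a [^]\<^bsub>?G\<^esub> (2 ^ (s - 1) :: nat)) [^]\<^bsub>?G\<^esub> (2::nat)"
        unfolding b two_s using a by (rule G.nat_pow_pow[symmetric])
      then show "b \<in> ?S"
        unfolding S using G.nat_pow_closed[OF a] by (rule image_eqI)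
    qed
    moreover have "subgroup ?O ?G"
      unfolding O by (rule G.subgroup_powers[OF powers])
    moreover have "card ?O = t"
      using G.card_powers[OF powers, of "2 ^ s"] by (simp add: O N)
    moreover have "card ?S = 2 ^ (s - 1) * t"
      using card_S q two_s by simp
    ultimately show ?thesis by blast
  qed

  \<comment> \<open>The claims that do not mention \<open>s\<close> and \<open>t\<close> also rest on such a decomposition of \<open>q - 1\<close>;
    \<open>s \<ge> 1\<close> because \<open>q\<close> is odd.\<close>
  have "q - 1 \<noteq> 0" "\<not> is_unit (2::nat)"
    using \<open>q > 1\<close> by auto
  then obtain t where t: "q - 1 = 2 ^ multiplicity 2 (q - 1) * t" "odd t"
    using multiplicity_decompose' by blast
  define s where "s = multiplicity 2 (q - 1)"
  have q: "q = 2 ^ s * t + 1"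
    using t(1) \<open>q > 1\<close> by (simp add: s_def)
  have s: "s \<ge> 1"
    using q t(2) assms(2) by (cases s) auto
  note st = main[OF s t(2) q]

  have fin_S: "finite ?S"
    using fin by (simp add: S)
  have "?O = ?S \<longleftrightarrow> card ?O = card ?S"
    using st fin_S by (metis card_subset_eq)
  also have "\<dots> \<longleftrightarrow> s = 1"
    using st s odd_pos[OF t(2)] one_less_power[of "2::nat" "s - 1"]
    by (cases "s = 1") auto
  also have "\<dots> \<longleftrightarrow> [q = 3] (mod 4)"
  proof (cases "s = 1")
    case True
    then show ?thesis
      using q t(2) by (auto simp: cong_def elim!: oddE)
  next
    case False
    then obtain r where "s = r + 2"
      using s by (metis One_nat_def Suc_1 add.commute le_Suc_eq le_add_diff_inverse not_less_eq_eq)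
    then have "q = 4 * (2 ^ r * t) + 1"
      using q by simp
    then have "q mod 4 = 1"
      by simp
    then show ?thesis
      using False by (simp add: cong_def)
  qed
  finally have iff: "?O = ?S \<longleftrightarrow> [q = 3] (mod 4)" .

  have counts: "card ?O = t \<and> card (?S - ?O) = (2 ^ (s - 1) - 1) * t"
    if "s \<ge> 1 \<and> odd t \<and> q = 2 ^ s * t + 1" for s t :: nat
  proof -
    have *: "?O \<subseteq> ?S" "card ?O = t" "card ?S = 2 ^ (s - 1) * t"
      using main[of s t] that by auto
    then have "card (?S - ?O) = 2 ^ (s - 1) * t - t"
      using fin_S by (simp add: card_Diff_subset finite_subset)
    then show ?thesis
      using * by (simp add: diff_mult_distrib)
  qed
  show ?thesis
    using sub_S st counts iff by blast
qed

end
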